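(* Let $n_r>n_{r-1}>\cdots>n_1>0$ be integers ($r\ge 1$), let $a_0,a_{n_1},\ldots,a_{n_r}$ be nonzero integers, and let $f(x)=a_{n_r}x^{n_r}+\cdots+a_{n_1}x^{n_1}+a_0\in \mathbb{Z}[x]$ satisfy $|a_0|= |a_{n_1}|+\cdots+|a_{n_r}|$. Let $$f_c(x)= \gcd\bigl(x^{n_r}+\operatorname{sgn}(a_0a_{n_r}),\, x^{n_{r-1}}+\operatorname{sgn}(a_0a_{n_{r-1}}),\, \ldots,\, x^{n_1}+\operatorname{sgn}(a_0a_{n_1})\bigr).$$ If $f(x)$ has a cyclotomic factor, then $f_c(x)\mid f(x)$ and $f_c(x)$ is the product of all cyclotomic factors of $f(x)$.
   Context: $\operatorname{sgn}(x)$ denotes the sign of the real number $x$, and the gcd of polynomials is the monic one. A cyclotomic factor of $f$ is a cyclotomic polynomial $\Phi_t(x)$, $t\ge 1$, dividing $f(x)$; the product of all cyclotomic factors is taken with multiplicity. *)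

theory Defs
  imports Complex_Main "HOL-Computational_Algebra.Computational_Algebra"
begin

definition complex_cyclotomic :: "nat \<Rightarrow> complex poly" where
  "complex_cyclotomic t =
     (\<Prod>k | k \<in> {1..t} \<and> coprime k t. [:- cis (2 * pi * real k / real t), 1:])"

text \<open>
  The description is proper for positive indices, see \<open>map_poly_cyclotomic\<close> below.
\<close>

definition cyclotomic :: "nat \<Rightarrow> int poly" where
  "cyclotomic t = (THE p. map_poly of_int p = complex_cyclotomic t)"

text \<open>
  The index set is finite for nonzero polynomials, see \<open>finite_cyclotomic_factors\<close> below, and
  distinct indices give distinct cyclotomic polynomials.
\<close>

definition cyclotomic_part :: "int poly \<Rightarrow> int poly" where
  "cyclotomic_part f =
     (\<Prod>t | t \<ge> 1 \<and> cyclotomic t dvd f. cyclotomic t ^ multiplicity (cyclotomic t) f)"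

lemma map_poly_of_int_mult:
  "map_poly of_int (p * q) = (map_poly of_int p * map_poly of_int q :: complex poly)"
  by (rule poly_eqI) (simp add: coeff_map_poly coeff_mult)

lemma map_poly_of_int_add:
  "map_poly of_int (p + q) = (map_poly of_int p + map_poly of_int q :: complex poly)"
  by (rule poly_eqI) (simp add: coeff_map_poly)

lemma map_poly_of_int_diff:
  "map_poly of_int (p - q) = (map_poly of_int p - map_poly of_int q :: complex poly)"
  by (rule poly_eqI) (simp add: coeff_map_poly)

lemma map_poly_of_int_prod:
  "map_poly of_int (\<Prod>i\<in>A. h i) = (\<Prod>i\<in>A. map_poly of_int (h i) :: complex poly)"
  by (induction A rule: infinite_finite_induct) (simp_all add: map_poly_of_int_mult)

lemma map_poly_of_int_inject:
  "map_poly of_int p = (map_poly of_int q :: complex poly) \<longleftrightarrow> p = q"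
  by (auto simp: poly_eq_iff coeff_map_poly)

lemma degree_map_poly_of_int: "degree (map_poly of_int p :: complex poly) = degree p"
  by (rule degree_map_poly) auto

lemma cis_eq_cis_frac:
  assumes "j \<in> {1..t}" "k \<in> {1..t}" "cis (2 * pi * real j / real t) = cis (2 * pi * real k / real t)"
  shows   "j = k"
proof -
  have t: "t > 0" using assms by auto
  have *: "cis (2 * pi * real (i mod t) / real t) = cis (2 * pi * real i / real t)" for i
  proof -
    have "real i = real (i mod t) + real t * real (i div t)"
      by (metis of_nat_add of_nat_mult mod_mult_div_eq)
    hence "2 * pi * real i / real t = 2 * pi * real (i mod t) / real t + 2 * pi * real (i div t)"
      using t by (simp add: field_simps)
    thus ?thesis by (simp flip: cis_mult)
  qed
  have "inj_on (\<lambda>k. cis (2 * pi * real k / real t)) {..<t}"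
    using bij_betw_roots_unity[OF t] by (simp add: bij_betw_def)
  hence "j mod t = k mod t"
    using assms t by (auto dest!: inj_onD[where x = "j mod t" and y = "k mod t"] simp: *)
  thus ?thesis using assms
    by (cases "j = t"; cases "k = t") auto
qed

lemma prod_roots_of_unity:
  assumes t: "t > 0"
  shows   "(\<Prod>k\<in>{1..t}. [:- cis (2 * pi * real k / real t), 1:]) = monom 1 t - 1"
    (is "?P = ?R")
proof (rule ccontr)
  let ?c = "\<lambda>k. cis (2 * pi * real k / real t)"
  assume "?P \<noteq> ?R"
  define D where "D = ?P - ?R"
  have D: "D \<noteq> 0" using \<open>?P \<noteq> ?R\<close> by (simp add: D_def)
  have degP: "degree ?P = t"
    by (subst degree_prod_sum_eq) auto
  have lcP: "lead_coeff ?P = 1"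
    by (subst lead_coeff_prod) auto
  have degR: "degree ?R = t" and lcR: "coeff ?R t = 1"
  proof -
    have "coeff (1 :: complex poly) t = 0"
      using t by (intro coeff_eq_0) simp
    then show *: "coeff ?R t = 1"
      by (simp only: coeff_diff coeff_monom if_True diff_zero refl)
    show "degree ?R = t"
      using t by (intro antisym degree_diff_le le_degree) (auto simp: degree_monom_le *)
  qed
  have deg: "degree D < t"
  proof -
    have "degree D \<le> t"
      unfolding D_def by (rule degree_diff_le[OF eq_refl[OF degP] eq_refl[OF degR]])
    moreover have "coeff D t = 0"
      using lcP lcR unfolding D_def degP coeff_diff by simp
    ultimately show ?thesis using D
      by (metis le_neq_implies_less leading_coeff_0_iff)
  qed
  have "?c ` {1..t} \<subseteq> {z. poly D z = 0}"
  proof safe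
    fix k assume k: "k \<in> {1..t}"
    have "?c k ^ t = cis (2 * pi * real k)"
      using t by (simp add: DeMoivre)
    hence "?c k ^ t = 1"
      using cis_multiple_2pi[of "real k"] by simp
    moreover have "poly ?P (?c k) = 0"
      using k by (auto simp: poly_prod)
    ultimately show "poly D (?c k) = 0"
      by (simp add: D_def poly_monom)
  qed
  moreover have "card (?c ` {1..t}) = t"
    by (subst card_image) (rule inj_onI, rule cis_eq_cis_frac, assumption+, simp)
  ultimately have "t \<le> card {z. poly D z = 0}"
    using card_mono[OF poly_roots_finite[OF D]] by metis
  also have "\<dots> \<le> degree D" by (rule card_poly_roots_bound[OF D])
  finally show False using deg by simp
qed

lemma prod_complex_cyclotomic:
  assumes t: "t > 0"
  shows   "(\<Prod>d | d dvd t. complex_cyclotomic d) = monom 1 t - 1"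
proof -
  let ?g = "\<lambda>x. [:- cis (2 * pi * x), 1:]"
  have fin: "finite {d. d dvd t}" using t by simp
  have "(\<Prod>d | d dvd t. complex_cyclotomic d) =
          (\<Prod>(d,k)\<in>(SIGMA d:{d. d dvd t}. {k. k \<in> {1..d} \<and> coprime k d}). ?g (real k / real d))"
    unfolding complex_cyclotomic_def using fin by (subst prod.Sigma) (auto simp: mult_ac)
  also have "\<dots> = (\<Prod>j\<in>{1..t}. ?g (real j / real t))"
  proof (rule prod.reindex_bij_witness[where i = "\<lambda>j. (t div gcd j t, j div gcd j t)"
                                         and j = "\<lambda>(d,k). k * (t div d)"])
    fix x assume "x \<in> (SIGMA d:{d. d dvd t}. {k. k \<in> {1..d} \<and> coprime k d})"
    then obtain d k where x: "x = (d, k)" "d dvd t" "1 \<le> k" "k \<le> d" "coprime k d" by auto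
    then obtain e where e: "t = d * e" by (auto elim: dvdE)
    have de: "d > 0" "e > 0" using t e by auto
    have "gcd (k * e) (d * e) = e * gcd k d"
      by (metis gcd_mult_distrib_nat mult.commute)
    hence g: "gcd (k * e) (d * e) = e"
      using x(5) by simp
    show "(t div gcd (case x of (d,k) \<Rightarrow> k * (t div d)) t, 
           (case x of (d,k) \<Rightarrow> k * (t div d)) div gcd (case x of (d,k) \<Rightarrow> k * (t div d)) t) = x"
      using de g by (simp add: x(1) e)
    show "(case x of (d,k) \<Rightarrow> k * (t div d)) \<in> {1..t}"
      using de x by (simp add: e Suc_le_eq)
    show "?g (real (case x of (d,k) \<Rightarrow> k * (t div d)) / real t) =
            (case x of (d,k) \<Rightarrow> ?g (real k / real d))"
      using de by (simp add: x(1) e)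
  next
    fix j assume j: "j \<in> {1..t}"
    define g where "g = gcd j t"
    obtain u v where uv: "j = u * g" "t = v * g" "coprime u v"
      using gcd_coprime_exists[of j t] j unfolding g_def by force
    have pos: "g > 0" "u > 0" "v > 0" using j uv by auto
    show "(case (t div gcd j t, j div gcd j t) of (d,k) \<Rightarrow> k * (t div d)) = j"
      unfolding g_def[symmetric] using pos by (simp add: uv)
    show "(t div gcd j t, j div gcd j t) \<in> (SIGMA d:{d. d dvd t}. {k. k \<in> {1..d} \<and> coprime k d})"
      unfolding g_def[symmetric] using pos uv j by (auto simp: Suc_le_eq)
  qed
  also have "\<dots> = monom 1 t - 1"
    using prod_roots_of_unity[OF t] by (simp add: mult_ac)
  finally show ?thesis .
qed

lemma lead_coeff_complex_cyclotomic: "lead_coeff (complex_cyclotomic t) = 1"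
  unfolding complex_cyclotomic_def by (subst lead_coeff_prod) auto

lemma complex_cyclotomic_integral:
  assumes "t > 0"
  shows   "\<exists>p. map_poly of_int p = complex_cyclotomic t"
  using assms
proof (induction t rule: less_induct)
  case (less t)
  define S where "S = {d. d dvd t \<and> d < t}"
  have "\<forall>d\<in>S. \<exists>p. map_poly of_int p = complex_cyclotomic d"
    using less by (auto simp: S_def intro: dvd_pos_nat)
  then obtain h where h: "\<And>d. d \<in> S \<Longrightarrow> map_poly of_int (h d) = complex_cyclotomic d"
    by metis
  define q where "q = (\<Prod>d\<in>S. h d)"
  have q: "map_poly of_int q = (\<Prod>d\<in>S. complex_cyclotomic d)"
    by (simp add: q_def map_poly_of_int_prod h)
  have "lead_coeff (map_poly of_int q :: complex poly) = 1"
    by (simp add: q lead_coeff_prod lead_coeff_complex_cyclotomic)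
  hence lcq: "lead_coeff q = 1"
    by (simp add: degree_map_poly_of_int coeff_map_poly)
  have q0: "q \<noteq> 0" using lcq by auto
  obtain s r where sr: "pseudo_divmod (monom 1 t - 1) q = (s, r)" by force
  have eq: "monom 1 t - 1 = q * s + r" and r: "r = 0 \<or> degree r < degree q"
    using pseudo_divmod[OF q0 sr] lcq by auto
  have "{d. d dvd t} = insert t S"
    using less.prems by (auto simp: S_def dest: dvd_imp_le)
  moreover have "t \<notin> S" "finite S" by (auto simp: S_def)
  ultimately have "complex_cyclotomic t * map_poly of_int q = monom 1 t - 1"
    using prod_complex_cyclotomic[OF less.prems] by (simp add: q)
  also have "\<dots> = map_poly of_int (monom 1 t - 1)"
    by (simp add: map_poly_of_int_diff map_poly_monom)
  also have "\<dots> = map_poly of_int q * map_poly of_int s + map_poly of_int r"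
    unfolding eq by (simp add: map_poly_of_int_add map_poly_of_int_mult)
  finally have *: "map_poly of_int q * (complex_cyclotomic t - map_poly of_int s) =
                     (map_poly of_int r :: complex poly)"
    by (simp add: algebra_simps)
  have "complex_cyclotomic t - map_poly of_int s = 0"
  proof (rule ccontr)
    assume neq: "complex_cyclotomic t - map_poly of_int s \<noteq> 0"
    have q0': "(map_poly of_int q :: complex poly) \<noteq> 0"
      using q0 map_poly_of_int_inject[of q 0] by simp
    have "degree (map_poly of_int r :: complex poly) \<ge> degree q"
      unfolding *[symmetric] using neq q0' by (simp add: degree_mult_eq degree_map_poly_of_int)
    hence "r = 0" using r by (simp add: degree_map_poly_of_int)
    thus False using * neq q0' by simp
  qed
  thus ?case by (intro exI[of _ s]) simp
qed

lemma map_poly_cyclotomic: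
  assumes "t > 0"
  shows   "map_poly of_int (cyclotomic t) = complex_cyclotomic t"
proof -
  obtain p :: "int poly" where p: "map_poly of_int p = complex_cyclotomic t"
    using complex_cyclotomic_integral[OF assms] by blast
  have "\<exists>!p. map_poly of_int p = complex_cyclotomic t"
    using p by (intro ex1I[of _ p]) (auto simp flip: map_poly_of_int_inject)
  thus ?thesis unfolding cyclotomic_def by (rule theI')
qed

lemma finite_cyclotomic_factors:
  assumes "f \<noteq> 0"
  shows   "finite {t. t \<ge> 1 \<and> cyclotomic t dvd f}"
proof (rule finite_imageD)
  let ?c = "\<lambda>t::nat. cis (2 * pi / real t)"
  define F where "F = (map_poly of_int f :: complex poly)"
  have "F \<noteq> 0" using assms map_poly_of_int_inject[of f 0] by (simp add: F_def)
  have "?c ` {t. t \<ge> 1 \<and> cyclotomic t dvd f} \<subseteq> {z. poly F z = 0}"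
  proof safe
    fix t :: nat assume t: "t \<ge> 1" "cyclotomic t dvd f"
    then obtain g where "f = cyclotomic t * g" by (auto elim: dvdE)
    hence "F = complex_cyclotomic t * map_poly of_int g"
      using t by (simp add: F_def map_poly_of_int_mult map_poly_cyclotomic)
    moreover have "poly (complex_cyclotomic t) (?c t) = 0"
      unfolding complex_cyclotomic_def poly_prod using t
      by (subst prod_zero_iff) (auto intro!: bexI[of _ 1])
    ultimately show "poly F (?c t) = 0" by simp
  qed
  thus "finite (?c ` {t. t \<ge> 1 \<and> cyclotomic t dvd f})"
    using poly_roots_finite[OF \<open>F \<noteq> 0\<close>] by (rule finite_subset)
  show "inj_on ?c {t. t \<ge> 1 \<and> cyclotomic t dvd f}"
  proof (rule inj_onI)
    fix s t :: nat
    assume st: "s \<in> {t. t \<ge> 1 \<and> cyclotomic t dvd f}" "t \<in> {t. t \<ge> 1 \<and> cyclotomic t dvd f}"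
      and eq: "?c s = ?c t"
    have "cis (2 * pi * real t / real (s * t)) = cis (2 * pi * real s / real (s * t))"
      using eq st by simp
    thus "s = t"
      using st by (intro cis_eq_cis_frac[of s "s * t" t]) simp_all
  qed
qed

text \<open>
  In the integer polynomials, the canonical gcd of a set with a monic member is monic.
\<close>

lemma lead_coeff_Gcd_monic:
  fixes A :: "int poly set"
  assumes "p \<in> A" "lead_coeff p = 1"
  shows   "lead_coeff (Gcd A) = 1"
proof -
  define l where "l = lead_coeff (Gcd A)"
  obtain q where q: "p = Gcd A * q" using Gcd_dvd[OF assms(1)] by (rule dvdE)
  have "l * lead_coeff q = 1"
    using assms(2) unfolding q lead_coeff_mult l_def .
  hence "l = 1 \<or> l = -1"
    by (auto simp: zmult_eq_1_iff)
  moreover have "l div unit_factor l = l"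
    using coeff_normalize[of "Gcd A" "degree (Gcd A)"] unfolding normalize_Gcd l_def by (rule sym)
  hence "l \<noteq> -1"
    by (intro notI) simp
  ultimately show ?thesis
    unfolding l_def[symmetric] by blast
qed

end

theory Submission
  imports Defs
begin

text \<open>
  Let \<open>e\<^sub>j = sgn (a 0 * a (n j))\<close>. Since \<open>\<bar>a 0\<bar>\<close> is the sum of the
  absolute values of the other coefficients, \<open>f\<close> is an integer combination of the binomials
  \<open>g\<^sub>j = x ^ n\<^sub>j + e\<^sub>j\<close>, namely \<open>f = (\<Sum>j. a (n j) g\<^sub>j)\<close>; hence their gcd \<open>fc\<close> divides \<open>f\<close>.

  A zero \<open>z\<close> of \<open>f\<close> on the unit circle is a case of equality in the triangle inequality
  (\<open>weighted_sum_one_plus_eq_0\<close>), which forces \<open>z ^ n\<^sub>j = - e\<^sub>j\<close> for every \<open>j\<close>. So on the unit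
  circle \<open>f\<close> vanishes exactly where all \<open>g\<^sub>j\<close> do, and there \<open>z f'(z)\<close> is, up to sign, equal to
  \<open>\<Sum>j. n\<^sub>j \<bar>a (n j)\<bar> > 0\<close>: these zeros are simple. Being simple, they make the cyclotomic
  part of \<open>f\<close> a product of distinct linear factors over the complex numbers
  (\<open>cyclotomic_part_eq_prod_linear_factors\<close>), and \<open>fc\<close>, a divisor of \<open>f\<close> and of
  \<open>x ^ n\<^sub>1 \<plusminus> 1\<close>, is such a product as well. The two monic polynomials therefore agree as soon
  as they have the same complex zeros.

  For the zeros, what matters is that the condition \<open>z ^ m = \<plusminus>1\<close> depends only on the order
  of the root of unity \<open>z\<close> (\<open>primitive_roots_of_unity_power_eq_sign\<close>). A zero of \<open>fc\<close> of order
  \<open>t\<close> hence brings all primitive \<open>t\<close>-th roots of unity along as zeros of \<open>f\<close>, so that the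
  \<open>t\<close>-th cyclotomic polynomial divides \<open>f\<close>. Conversely, a cyclotomic factor of \<open>f\<close>
  divides every \<open>g\<^sub>j\<close> over the integers, hence \<open>fc\<close>.
\<close>

section \<open>Primitive roots of unity\<close>

definition primitive_roots_of_unity :: "nat \<Rightarrow> complex set" where
  "primitive_roots_of_unity t =
     (\<lambda>k. cis (2 * pi * real k / real t)) ` {k. k \<in> {1..t} \<and> coprime k t}"

lemma finite_primitive_roots_of_unity [simp]: "finite (primitive_roots_of_unity t)"
  unfolding primitive_roots_of_unity_def by (rule finite_imageI) (rule finite_subset[of _ "{1..t}"], auto)

lemma norm_primitive_root_of_unity: "z \<in> primitive_roots_of_unity t \<Longrightarrow> norm z = 1"
  by (auto simp: primitive_roots_of_unity_def)

lemma primitive_roots_of_unity_nonempty: "t \<ge> 1 \<Longrightarrow> primitive_roots_of_unity t \<noteq> {}"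
  unfolding primitive_roots_of_unity_def by (auto intro!: exI[of _ 1])

text \<open>
  The distinctness of the primitive roots allows products over indices to become products over
  sets of zeros, which is the form in which polynomials are compared below.
\<close>

lemma complex_cyclotomic_eq_prod_primitive_roots:
  "complex_cyclotomic t = (\<Prod>z\<in>primitive_roots_of_unity t. [:-z, 1:])"
proof -
  have "inj_on (\<lambda>k. cis (2 * pi * real k / real t)) {k. k \<in> {1..t} \<and> coprime k t}"
    by (rule inj_onI, rule cis_eq_cis_frac[of _ t]) auto
  thus ?thesis
    unfolding complex_cyclotomic_def primitive_roots_of_unity_def
    by (simp add: prod.reindex)
qed

lemma poly_complex_cyclotomic_eq_0_iff:
  "poly (complex_cyclotomic t) z = 0 \<longleftrightarrow> z \<in> primitive_roots_of_unity t"
  by (auto simp: complex_cyclotomic_eq_prod_primitive_roots poly_prod)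

text \<open>
  Reduced fractions in \<open>(0, 1]\<close> have a unique denominator: with the common denominator \<open>s t\<close>,
  equality reads \<open>k t = l s\<close>, and coprimality makes \<open>s\<close> and \<open>t\<close> divide each other.
\<close>

lemma primitive_roots_of_unity_disjoint:
  assumes "z \<in> primitive_roots_of_unity s" "z \<in> primitive_roots_of_unity t"
  shows   "s = t"
proof -
  obtain k where k: "1 \<le> k" "k \<le> s" "coprime k s" "z = cis (2 * pi * real k / real s)"
    using assms(1) by (auto simp: primitive_roots_of_unity_def)
  obtain l where l: "1 \<le> l" "l \<le> t" "coprime l t" "z = cis (2 * pi * real l / real t)"
    using assms(2) by (auto simp: primitive_roots_of_unity_def)
  have "2 * pi * real (k * t) / real (s * t) = 2 * pi * real k / real s"
       "2 * pi * real (l * s) / real (s * t) = 2 * pi * real l / real t"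
    using k l by simp_all
  hence "cis (2 * pi * real (k * t) / real (s * t)) = cis (2 * pi * real (l * s) / real (s * t))"
    using k(4) l(4) by metis
  hence eq: "k * t = l * s"
    using k l by (intro cis_eq_cis_frac[of _ "s * t"]) auto
  have "s dvd k * t" "t dvd l * s"
    unfolding eq by (simp, simp flip: eq)
  hence "s dvd t" "t dvd s"
    using k(3) l(3) by (simp_all add: coprime_dvd_mult_right_iff coprime_commute)
  thus ?thesis by (rule dvd_antisym)
qed

lemma root_of_unity_primitive:
  assumes "z ^ m = 1" "m > 0"
  obtains t where "t \<ge> 1" "z \<in> primitive_roots_of_unity t"
proof -
  have "poly (\<Prod>d | d dvd m. complex_cyclotomic d) z = 0"
    using assms by (simp add: prod_complex_cyclotomic poly_monom)
  then obtain d where "d dvd m" "poly (complex_cyclotomic d) z = 0"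
    using assms(2) by (auto simp: poly_prod)
  with that[of d] assms(2) show ?thesis
    by (auto simp: poly_complex_cyclotomic_eq_0_iff Suc_le_eq intro: dvd_pos_nat)
qed

lemma primitive_root_of_unity_power_eq_1_iff:
  assumes "z \<in> primitive_roots_of_unity t"
  shows   "z ^ m = 1 \<longleftrightarrow> t dvd m"
proof -
  obtain k where k: "1 \<le> k" "k \<le> t" "coprime k t" "z = cis (2 * pi * real k / real t)"
    using assms by (auto simp: primitive_roots_of_unity_def)
  have pow: "z ^ m = cis (2 * pi * (real (m * k) / real t))"
    by (simp add: k(4) DeMoivre mult_ac)
  show ?thesis
  proof
    assume "z ^ m = 1"
    hence "cos (2 * pi * (real (m * k) / real t)) = 1"
      unfolding pow by (simp add: complex_eq_iff)
    then obtain i :: int where "2 * pi * (real (m * k) / real t) = of_int i * 2 * pi"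
      unfolding cos_one_2pi_int by blast
    hence "real (m * k) = of_int i * real t"
      using k by (simp add: field_simps)
    hence "int (m * k) = i * int t"
      by (metis of_int_eq_iff of_int_mult of_int_of_nat_eq)
    hence "t dvd m * k"
      by (metis dvd_triv_right int_dvd_int_iff)
    thus "t dvd m"
      using k(3) by (simp add: coprime_dvd_mult_left_iff coprime_commute)
  next
    assume "t dvd m"
    then obtain q where "m = t * q" by (auto elim: dvdE)
    hence "real (m * k) / real t = of_int (int (q * k))"
      using k by simp
    thus "z ^ m = 1"
      unfolding pow by (metis Ints_of_int cis_multiple_2pi)
  qed
qed

text \<open>
  The equation \<open>z ^ m = 1\<close> says \<open>t dvd m\<close>, and \<open>z ^ m = -1\<close> says \<open>t dvd 2 m\<close> without
  \<open>t dvd m\<close>; both are conditions on \<open>t\<close> alone, shared by all primitive \<open>t\<close>-th roots of unity.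
\<close>

lemma primitive_roots_of_unity_power_eq_sign:
  fixes u :: int
  assumes "z \<in> primitive_roots_of_unity t" "w \<in> primitive_roots_of_unity t"
    and "\<bar>u\<bar> = 1" "z ^ m = of_int u"
  shows "w ^ m = of_int u"
proof -
  have eq: "z ^ i = 1 \<longleftrightarrow> w ^ i = 1" for i
    using assms(1,2) by (simp add: primitive_root_of_unity_power_eq_1_iff)
  from assms(3) consider "u = 1" | "u = -1" by linarith
  thus ?thesis
  proof cases
    case 1
    thus ?thesis using assms(4) eq[of m] by simp
  next
    case 2
    hence "z ^ m \<noteq> 1" "z ^ (m * 2) = 1"
      using assms(4) by (simp_all add: power_mult)
    hence "w ^ m \<noteq> 1" "(w ^ m)\<^sup>2 = 1"
      using eq[of m] eq[of "m * 2"] by (simp_all add: power_mult)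
    with 2 show ?thesis by (simp add: power2_eq_1_iff)
  qed
qed

section \<open>Divisibility by cyclotomic polynomials\<close>

lemma prod_linear_factors_dvd:
  fixes p :: "'a :: idom poly"
  assumes "finite A" "\<And>z. z \<in> A \<Longrightarrow> poly p z = 0"
  shows   "(\<Prod>z\<in>A. [:-z, 1:]) dvd p"
  using assms
proof (induction A rule: finite_induct)
  case (insert a A)
  then obtain q where q: "p = (\<Prod>z\<in>A. [:-z, 1:]) * q" by (auto elim: dvdE)
  have "poly (\<Prod>z\<in>A. [:-z, 1:]) a \<noteq> 0"
    using insert.hyps by (auto simp: poly_prod)
  hence "poly q a = 0"
    using insert.prems[of a] q by simp
  hence "[:-a, 1:] dvd q" by (simp add: poly_eq_0_iff_dvd)
  thus ?case
    unfolding q using insert.hyps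
    by (metis mult.commute mult_dvd_mono dvd_refl prod.insert)
qed auto

text \<open>
  Division with remainder by a monic polynomial stays in the integers, and over the complex
  numbers the degree leaves no room for a nonzero remainder.
\<close>

lemma monic_dvd_map_poly_of_int:
  assumes "lead_coeff q = 1"
    and "(map_poly of_int q :: complex poly) dvd map_poly of_int p"
  shows   "q dvd p"
proof -
  have q0: "q \<noteq> 0" using assms(1) by auto
  obtain s r where sr: "pseudo_divmod p q = (s, r)" by force
  have eq: "p = q * s + r" and r: "r = 0 \<or> degree r < degree q"
    using pseudo_divmod[OF q0 sr] assms(1) by auto
  have "(map_poly of_int q :: complex poly) dvd map_poly of_int r"
    using assms(2) unfolding eq map_poly_of_int_add map_poly_of_int_mult
    by (simp only: dvd_add_right_iff dvd_triv_left)
  hence "(map_poly of_int r :: complex poly) = 0"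
    using r dvd_imp_degree_le[of "map_poly of_int q :: complex poly" "map_poly of_int r"]
    by (metis degree_map_poly_of_int map_poly_0 not_le)
  hence "r = 0"
    using map_poly_of_int_inject[of r 0] by simp
  thus ?thesis by (simp add: eq)
qed

lemma map_poly_of_int_smult:
  "map_poly of_int (smult c p) = smult (of_int c) (map_poly of_int p :: complex poly)"
  by (rule poly_eqI) (simp add: coeff_map_poly)

lemma map_poly_of_int_sum:
  "map_poly of_int (\<Sum>i\<in>A. h i) = (\<Sum>i\<in>A. map_poly of_int (h i) :: complex poly)"
  by (induction A rule: infinite_finite_induct) (simp_all add: map_poly_of_int_add)

text \<open>
  This turns divisibility over the integers into a condition on complex zeros and back. It
  avoids comparing greatest common divisors over the two rings.
\<close>

lemma cyclotomic_dvd_iff: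
  assumes "t \<ge> 1"
  shows "cyclotomic t dvd p \<longleftrightarrow>
           (\<forall>z\<in>primitive_roots_of_unity t. poly (map_poly of_int p) z = 0)"
proof
  assume "cyclotomic t dvd p"
  then obtain q where "p = cyclotomic t * q" by (auto elim: dvdE)
  thus "\<forall>z\<in>primitive_roots_of_unity t. poly (map_poly of_int p) z = 0"
    using assms
    by (simp add: map_poly_of_int_mult map_poly_cyclotomic poly_complex_cyclotomic_eq_0_iff)
next
  assume roots: "\<forall>z\<in>primitive_roots_of_unity t. poly (map_poly of_int p) z = 0"
  have "lead_coeff (map_poly of_int (cyclotomic t) :: complex poly) = 1"
    using assms by (simp add: map_poly_cyclotomic lead_coeff_complex_cyclotomic)
  hence "lead_coeff (cyclotomic t) = 1"
    by (simp add: degree_map_poly_of_int coeff_map_poly)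
  thus "cyclotomic t dvd p"
    using assms roots
    by (intro monic_dvd_map_poly_of_int)
       (simp_all add: map_poly_cyclotomic complex_cyclotomic_eq_prod_primitive_roots
          prod_linear_factors_dvd)
qed

text \<open>
  A square of a cyclotomic polynomial dividing \<open>f\<close> would produce a multiple zero on the unit
  circle, so all multiplicities are one. Distinct cyclotomic polynomials have disjoint sets of
  zeros, so the double product collapses to one over the union.
\<close>

lemma cyclotomic_part_eq_prod_linear_factors:
  assumes "f \<noteq> 0"
    and simple: "\<And>z. norm z = 1 \<Longrightarrow> poly (map_poly of_int f) z = 0 \<Longrightarrow>
                   poly (pderiv (map_poly of_int f)) z \<noteq> (0 :: complex)"
  shows "map_poly of_int (cyclotomic_part f) =
           (\<Prod>z\<in>(\<Union>t\<in>{t. t \<ge> 1 \<and> cyclotomic t dvd f}. primitive_roots_of_unity t). [:-z, 1:])"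
proof -
  let ?T = "{t. t \<ge> 1 \<and> cyclotomic t dvd f}"
  have "multiplicity (cyclotomic t) f = 1" if t: "t \<in> ?T" for t
  proof (rule multiplicity_eqI)
    show "cyclotomic t ^ 1 dvd f" using t by simp
    show "\<not> cyclotomic t ^ Suc 1 dvd f"
    proof
      assume "cyclotomic t ^ Suc 1 dvd f"
      then obtain g where "f = cyclotomic t ^ Suc 1 * g" by (rule dvdE)
      hence F: "map_poly of_int f = complex_cyclotomic t * (complex_cyclotomic t * map_poly of_int g)"
        using t by (simp add: map_poly_of_int_mult map_poly_cyclotomic mult.assoc)
      obtain z where z: "z \<in> primitive_roots_of_unity t"
        using primitive_roots_of_unity_nonempty[of t] t by auto
      have "poly (complex_cyclotomic t) z = 0"
        using z by (simp add: poly_complex_cyclotomic_eq_0_iff)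
      hence "poly (map_poly of_int f) z = 0" "poly (pderiv (map_poly of_int f)) z = 0"
        by (simp_all add: F pderiv_mult)
      with simple[of z] norm_primitive_root_of_unity[OF z] show False by simp
    qed
  qed
  hence "map_poly of_int (cyclotomic_part f) = (\<Prod>t\<in>?T. complex_cyclotomic t)"
    unfolding cyclotomic_part_def map_poly_of_int_prod
    by (intro prod.cong) (auto simp: map_poly_cyclotomic)
  also have "\<dots> = (\<Prod>z\<in>(\<Union>t\<in>?T. primitive_roots_of_unity t). [:-z, 1:])"
    unfolding complex_cyclotomic_eq_prod_primitive_roots
    using finite_cyclotomic_factors[OF assms(1)] primitive_roots_of_unity_disjoint
    by (subst prod.UNION_disjoint) auto
  finally show ?thesis .
qed

lemma pderiv_sum: "pderiv (\<Sum>i\<in>A. h i) = (\<Sum>i\<in>A. pderiv (h i))"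
  by (induction A rule: infinite_finite_induct) (simp_all add: pderiv_add)

section \<open>Zeros on the unit circle and the cyclotomic part\<close>

text \<open>
  The equality case of the triangle inequality: the real parts of the summands are nonnegative,
  so they all vanish, and \<open>-1\<close> is the only point of the closed unit disc with real part \<open>-1\<close>.
\<close>

lemma weighted_sum_one_plus_eq_0:
  fixes v :: "'i \<Rightarrow> complex" and b :: "'i \<Rightarrow> real"
  assumes "finite J" "\<And>j. j \<in> J \<Longrightarrow> b j > 0" "\<And>j. j \<in> J \<Longrightarrow> norm (v j) \<le> 1"
    and sum: "(\<Sum>j\<in>J. of_real (b j) * (1 + v j)) = 0"
    and j: "j \<in> J"
  shows "v j = -1"
proof -
  have nonneg: "b i * (1 + Re (v i)) \<ge> 0" if "i \<in> J" for i
    using assms(2,3)[OF that] abs_Re_le_cmod[of "v i"] by simp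
  have "(\<Sum>i\<in>J. b i * (1 + Re (v i))) = Re (\<Sum>i\<in>J. of_real (b i) * (1 + v i))"
    by simp
  hence "b j * (1 + Re (v j)) = 0"
    using sum_nonneg_eq_0_iff[of J "\<lambda>i. b i * (1 + Re (v i))"] assms(1) nonneg sum j by simp
  hence Re: "Re (v j) = -1"
    using assms(2)[OF j] by simp
  have "(Re (v j))\<^sup>2 + (Im (v j))\<^sup>2 \<le> 1"
    using assms(3)[OF j] by (simp add: cmod_def)
  thus ?thesis using Re by (simp add: complex_eq_iff)
qed

theorem proposition7:
  fixes r :: nat and n :: "nat \<Rightarrow> nat" and a :: "nat \<Rightarrow> int" and f fc :: "int poly"
  assumes r: "r \<ge> 1"
    and n_mono: "strict_mono_on {1..r} n"
    and n_pos: "n 1 > 0"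
    and a_0: "a 0 \<noteq> 0"
    and a_n: "\<And>j. j \<in> {1..r} \<Longrightarrow> a (n j) \<noteq> 0"
    and f: "f = (\<Sum>j=1..r. monom (a (n j)) (n j)) + [:a 0:]"
    and abs_a_0: "\<bar>a 0\<bar> = (\<Sum>j=1..r. \<bar>a (n j)\<bar>)"
    and fc: "fc = (GCD j\<in>{1..r}. monom 1 (n j) + [:sgn (a 0 * a (n j)):])"
    and cyclotomic_factor: "\<exists>t\<ge>1. cyclotomic t dvd f"
  shows "fc dvd f \<and> fc = cyclotomic_part f"
proof -
  define e where "e j = sgn (a 0 * a (n j))" for j
  define g where "g j = monom 1 (n j) + [:e j:]" for j
  define F where "F = (map_poly of_int f :: complex poly)"
  define Fc where "Fc = (map_poly of_int fc :: complex poly)"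
  have n: "n j > 0" if "j \<in> {1..r}" for j
    using n_pos strict_mono_onD[OF n_mono, of 1 j] that r by (cases "j = 1") auto
  have e: "\<bar>e j\<bar> = 1" "a (n j) = sgn (a 0) * (\<bar>a (n j)\<bar> * e j)" "a (n j) * e j = sgn (a 0) * \<bar>a (n j)\<bar>"
    if "j \<in> {1..r}" for j
    using a_0 a_n[OF that] by (auto simp: e_def sgn_if abs_if mult_less_0_iff zero_less_mult_iff split: if_splits)
  have fc_g: "fc = Gcd (g ` {1..r})"
    by (simp add: fc g_def e_def)

  have f_g: "f = (\<Sum>j=1..r. smult (a (n j)) (g j))"
  proof -
    have "a 0 = (\<Sum>j=1..r. a (n j) * e j)"
      using e(3) sgn_mult_abs[of "a 0"]
      unfolding abs_a_0 by (simp flip: sum_distrib_left)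
    hence "[:a 0:] = (\<Sum>j=1..r. [:a (n j) * e j:])"
      by (simp add: poly_eq_iff coeff_sum coeff_pCons split: nat.splits)
    thus ?thesis
      by (simp add: f g_def smult_add_right smult_monom sum.distrib)
  qed
  have fc_dvd: "fc dvd f"
    unfolding f_g fc_g by (intro dvd_sum dvd_smult Gcd_dvd) auto

  have monic_g: "lead_coeff (g j) = 1" if "j \<in> {1..r}" for j
  proof -
    have "degree (g j) = n j"
      using n[OF that] unfolding g_def by (subst degree_add_eq_left) (simp_all add: degree_monom_eq)
    thus ?thesis
      using n[OF that] by (simp add: g_def coeff_pCons split: nat.splits)
  qed
  have fc_monic: "lead_coeff fc = 1"
    unfolding fc_g by (rule lead_coeff_Gcd_monic[of "g 1"]) (use r monic_g[of 1] in auto)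

  have poly_g: "poly (map_poly of_int (g j)) z = z ^ n j + of_int (e j)" for j and z :: complex
    by (simp add: g_def map_poly_of_int_add map_poly_monom poly_monom map_poly_pCons)
  have F_g: "F = (\<Sum>j=1..r. smult (of_int (a (n j))) (monom 1 (n j) + [:of_int (e j):]))"
    by (simp add: F_def f_g g_def map_poly_of_int_sum map_poly_of_int_smult map_poly_of_int_add
        map_poly_monom map_poly_pCons)
  have poly_F: "poly F z = (\<Sum>j=1..r. of_int (a (n j)) * (z ^ n j + of_int (e j)))" for z
    by (simp add: F_g poly_sum poly_monom)
  have f0: "f \<noteq> 0"
  proof
    assume "f = 0"
    moreover have "coeff f 0 = a 0"
      using n by (fastforce simp: f coeff_sum intro!: sum.neutral)
    ultimately show False using a_0 by simp
  qed

  have root_F: "z ^ n j = of_int (- e j)"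
    if z: "norm z = 1" "poly F z = 0" and j: "j \<in> {1..r}" for z j
  proof -
    have e_sq: "(of_int (e i) * of_int (e i) :: complex) = 1" if "i \<in> {1..r}" for i
      using e(1)[OF that] by (metis abs_mult_self_eq mult_1 of_int_1 of_int_mult)
    \<comment> \<open>Multiplying \<open>z ^ n i + e i\<close> by the sign \<open>e i\<close> makes all coefficients positive multiples
      of the common sign of \<open>a 0\<close>.\<close>
    have "of_int (a (n i)) * (z ^ n i + of_int (e i)) =
            of_int (sgn (a 0)) * (of_real (of_int \<bar>a (n i)\<bar>) * (1 + of_int (e i) * z ^ n i))"
      if "i \<in> {1..r}" for i
    proof -
      have "of_int (a (n i)) = (of_int (sgn (a 0)) * (of_int \<bar>a (n i)\<bar> * of_int (e i)) :: complex)"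
        using e(2)[OF that] by (metis of_int_mult)
      hence "of_int (a (n i)) * (z ^ n i + of_int (e i)) =
        of_int (sgn (a 0)) * (of_int \<bar>a (n i)\<bar> * (of_int (e i) * of_int (e i) + of_int (e i) * z ^ n i))"
        by (simp add: algebra_simps)
      thus ?thesis using e_sq[OF that] by (simp del: of_int_abs)
    qed
    hence "poly F z = of_int (sgn (a 0)) *
             (\<Sum>i=1..r. of_real (of_int \<bar>a (n i)\<bar>) * (1 + of_int (e i) * z ^ n i))"
      unfolding poly_F sum_distrib_left by (intro sum.cong) auto
    hence "(\<Sum>i=1..r. of_real (of_int \<bar>a (n i)\<bar>) * (1 + of_int (e i) * z ^ n i)) = 0"
      using z(2) a_0 by (simp add: sgn_0_0)
    moreover have "norm (of_int (e i) * z ^ n i) \<le> 1" if "i \<in> {1..r}" for i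
      using e(1)[OF that] z(1) by (simp add: norm_mult norm_power flip: of_int_abs)
    ultimately have "of_int (e j) * z ^ n j = -1"
      using a_n j by (intro weighted_sum_one_plus_eq_0[where J = "{1..r}"]) auto
    hence "of_int (e j) * (of_int (e j) * z ^ n j) = - of_int (e j)" by simp
    thus ?thesis using e_sq[OF j] by (simp flip: mult.assoc)
  qed

  have simple: "poly (pderiv F) z \<noteq> 0" if z: "norm z = 1" "poly F z = 0" for z
  proof -
    have "z * poly (pderiv F) z = (\<Sum>j=1..r. of_int (a (n j)) * of_nat (n j) * (z * z ^ (n j - 1)))"
      by (simp add: F_g pderiv_sum pderiv_smult pderiv_add pderiv_monom pderiv_pCons poly_sum
          poly_monom sum_distrib_left mult_ac)
    also have "\<dots> = (\<Sum>j=1..r. of_int (- sgn (a 0) * (int (n j) * \<bar>a (n j)\<bar>)))"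
    proof (intro sum.cong refl)
      fix j assume j: "j \<in> {1..r}"
      have "z * z ^ (n j - 1) = of_int (- e j)"
        using root_F[OF z j] n[OF j] by (simp flip: power_Suc)
      hence "of_int (a (n j)) * of_nat (n j) * (z * z ^ (n j - 1)) =
               of_int (- (a (n j) * e j) * int (n j))" by simp
      also have "- (a (n j) * e j) * int (n j) = - sgn (a 0) * (int (n j) * \<bar>a (n j)\<bar>)"
        unfolding e(3)[OF j] by simp
      finally show "of_int (a (n j)) * of_nat (n j) * (z * z ^ (n j - 1)) =
                      (of_int (- sgn (a 0) * (int (n j) * \<bar>a (n j)\<bar>)) :: complex)" .
    qed
    also have "\<dots> = of_int (- sgn (a 0) * (\<Sum>j=1..r. int (n j) * \<bar>a (n j)\<bar>))"
      unfolding sum_distrib_left by simp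
    also have "(\<Sum>j=1..r. int (n j) * \<bar>a (n j)\<bar>) > 0"
      using r n a_n by (intro sum_pos) auto
    hence "of_int (- sgn (a 0) * (\<Sum>j=1..r. int (n j) * \<bar>a (n j)\<bar>)) \<noteq> (0 :: complex)"
      using a_0 unfolding of_int_eq_0_iff by (simp add: sgn_0_0)
    finally show ?thesis by auto
  qed

  have root_Fc: "z ^ n j = of_int (- e j)" if z: "poly Fc z = 0" and j: "j \<in> {1..r}" for z j
  proof -
    have "fc dvd g j" unfolding fc_g by (rule Gcd_dvd) (use j in auto)
    then obtain q where "g j = fc * q" by (auto elim: dvdE)
    hence "poly (map_poly of_int (g j)) z = 0"
      using z by (simp add: Fc_def map_poly_of_int_mult)
    thus ?thesis by (simp add: poly_g add_eq_0_iff2)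
  qed
  have roots: "{z. poly Fc z = 0} =
      (\<Union>t\<in>{t. t \<ge> 1 \<and> cyclotomic t dvd f}. primitive_roots_of_unity t)" (is "_ = ?R")
  proof (intro equalityI subsetI)
    fix z assume "z \<in> {z. poly Fc z = 0}"
    hence z: "z ^ n j = of_int (- e j)" if "j \<in> {1..r}" for j
      using root_Fc that by blast
    \<comment> \<open>Squaring \<open>z ^ n 1 = \<plusminus>1\<close> shows that \<open>z\<close> is a root of unity.\<close>
    have "\<bar>e 1\<bar> = 1" "n 1 > 0" using e(1) n r by auto
    hence "z ^ (n 1 * 2) = 1"
      using z[of 1] r by (auto simp: power_mult abs_if split: if_splits)
    then obtain t where t: "t \<ge> 1" "z \<in> primitive_roots_of_unity t"
      using root_of_unity_primitive[of z "n 1 * 2"] \<open>n 1 > 0\<close> by auto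
    have "poly F w = 0" if w: "w \<in> primitive_roots_of_unity t" for w
    proof -
      have "w ^ n j = of_int (- e j)" if "j \<in> {1..r}" for j
        using primitive_roots_of_unity_power_eq_sign[OF t(2) w _ z] e(1) that by simp
      thus ?thesis by (simp add: poly_F)
    qed
    hence "cyclotomic t dvd f"
      using t(1) by (simp add: cyclotomic_dvd_iff F_def)
    thus "z \<in> ?R" using t by auto
  next
    fix z assume "z \<in> ?R"
    then obtain t where t: "t \<ge> 1" "cyclotomic t dvd f" "z \<in> primitive_roots_of_unity t"
      by auto
    have "cyclotomic t dvd g j" if j: "j \<in> {1..r}" for j
      unfolding cyclotomic_dvd_iff[OF t(1)]
    proof
      fix w assume w: "w \<in> primitive_roots_of_unity t"
      hence "poly F w = 0" using t by (simp add: cyclotomic_dvd_iff F_def)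
      thus "poly (map_poly of_int (g j)) w = 0"
        using root_F[OF norm_primitive_root_of_unity[OF w] _ j] by (simp add: poly_g)
    qed
    hence "cyclotomic t dvd fc"
      unfolding fc_g by (intro Gcd_greatest) auto
    thus "z \<in> {z. poly Fc z = 0}"
      using t by (simp add: cyclotomic_dvd_iff Fc_def)
  qed

  have "rsquarefree Fc"
    unfolding rsquarefree_roots
  proof (intro allI notI, elim conjE)
    fix z assume z: "poly Fc z = 0" "poly (pderiv Fc) z = 0"
    obtain q where "f = fc * q" using fc_dvd by (rule dvdE)
    hence "F = Fc * map_poly of_int q" by (simp add: F_def Fc_def map_poly_of_int_mult)
    hence "poly F z = 0" "poly (pderiv F) z = 0"
      using z by (simp_all add: pderiv_mult)
    moreover have "norm z = 1"
      using z(1) roots norm_primitive_root_of_unity by blast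
    ultimately show False using simple by blast
  qed
  moreover have "lead_coeff Fc = 1"
    using fc_monic by (simp add: Fc_def degree_map_poly_of_int coeff_map_poly)
  ultimately have "Fc = (\<Prod>z | poly Fc z = 0. [:-z, 1:])"
    using complex_poly_decompose_rsquarefree[of Fc] by simp
  also have "\<dots> = map_poly of_int (cyclotomic_part f)"
    unfolding roots using f0 simple
    by (intro cyclotomic_part_eq_prod_linear_factors [symmetric]) (auto simp: F_def)
  finally have "fc = cyclotomic_part f"
    by (simp add: Fc_def map_poly_of_int_inject)
  with fc_dvd show ?thesis by blast
qed

end
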